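(* For all nonnegative integers $h,k$, $$D_q(h,k)=\sum_{\mathfrak{l}\in\mathcal{P}_{h,k}}q^{\sigma(\mathfrak{l})}.$$
   Context: The $q$-integer is $[m]_q=(1-q^m)/(1-q)$ and the $q$-binomial coefficient is $\left[{h\atop k}\right]_q=\frac{[h]_q[h-1]_q\cdots[h-k+1]_q}{[k]_q[k-1]_q\cdots[1]_q}$, with $\left[{h\atop 0}\right]_q=1$ and $\left[{h\atop k}\right]_q=0$ for $k<0$. For nonnegative integers $h,k$ the $q$-Delannoy number is $D_q(h,k)=\sum_{j=0}^{h}q^{\binom{j+1}{2}}\left[{k\atop j}\right]_q\left[{h+k-j\atop k}\right]_q$. A lattice path is a finite sequence of steps $\mathfrak{l}=\langle\vec e_1,\ldots,\vec e_m\rangle$ with each $\vec e_j\in\{(1,0),(0,1),(1,1)\}$; $\mathcal{P}_{h,k}$ is the set of such paths from $(0,0)$ to $(h,k)$. For a step $\vec e$ write $\mathbf{x}(\vec e),\mathbf{y}(\vec e)$ for its coordinates, and for a path $\mathbf{x}(\mathfrak{l})=\sum_j\mathbf{x}(\vec e_j)$, $\mathbf{y}(\mathfrak{l})=\sum_j\mathbf{y}(\vec e_j)$. Define $\sigma(\mathfrak{l})=\sum_{1\le j\le m,\ \mathbf{y}(\vec e_j)=1}\mathbf{x}(\langle\vec e_1,\ldots,\vec e_j\rangle)$, i.e. for a path starting at the origin, the sum of the $x$-coordinates of the endpoints of the steps $(0,1)$ and $(1,1)$. *)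

theory Defs
  imports Complex_Main "HOL-Computational_Algebra.Computational_Algebra"
begin

text \<open>
  The parameter \<open>q\<close> is an element of an arbitrary field. Reading \<open>q\<close> as an indeterminate amounts to
  taking the field of rational functions and \<open>q = Fract [:0, 1:] 1\<close>. The formulas below carry
  their mathematical meaning only where the denominators do not vanish, i.e. when the relevant
  powers of \<open>q\<close> differ from 1; see \<open>indeterminate_power_neq_1\<close> for the formal case.
\<close>

definition qint :: "'a::field \<Rightarrow> int \<Rightarrow> 'a" where
  "qint q m = (1 - q powi m) / (1 - q)"

definition qbinom :: "'a::field \<Rightarrow> int \<Rightarrow> int \<Rightarrow> 'a" where
  "qbinom q h k =
     (if k < 0 then 0
      else (\<Prod>i<nat k. qint q (h - int i)) / (\<Prod>i<nat k. qint q (k - int i)))"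

definition qDelannoy :: "'a::field \<Rightarrow> nat \<Rightarrow> nat \<Rightarrow> 'a" where
  "qDelannoy q h k =
     (\<Sum>j=0..h. q ^ ((j + 1) choose 2) * qbinom q (int k) (int j)
                 * qbinom q (int h + int k - int j) (int k))"

type_synonym step = "nat \<times> nat"

definition steps :: "step set" where
  "steps = {(1, 0), (0, 1), (1, 1)}"

definition path_x :: "step list \<Rightarrow> nat" where
  "path_x l = (\<Sum>e\<leftarrow>l. fst e)"

definition path_y :: "step list \<Rightarrow> nat" where
  "path_y l = (\<Sum>e\<leftarrow>l. snd e)"

definition paths :: "nat \<Rightarrow> nat \<Rightarrow> step list set" where
  "paths h k = {l. set l \<subseteq> steps \<and> path_x l = h \<and> path_y l = k}"

text \<open>The \<open>j\<close>-th step, counted from 1, is \<open>l ! (j - 1)\<close>.\<close>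

definition path_sigma :: "step list \<Rightarrow> nat" where
  "path_sigma l =
     (\<Sum>j | 1 \<le> j \<and> j \<le> length l \<and> snd (l ! (j - 1)) = 1. path_x (take j l))"

lemma length_le_path:
  assumes "set l \<subseteq> steps"
  shows "length l \<le> path_x l + path_y l"
  using assms by (induction l) (auto simp: steps_def path_x_def path_y_def)

lemma finite_paths: "finite (paths h k)"
proof (rule finite_subset)
  show "paths h k \<subseteq> {l. set l \<subseteq> steps \<and> length l \<le> h + k}"
    using length_le_path by (auto simp: paths_def)
  show "finite {l. set l \<subseteq> steps \<and> length l \<le> h + k}"
    by (rule finite_lists_length_le) (simp add: steps_def)
qed

lemma indeterminate_power_neq_1:
  assumes "m > 0"
  shows "(Fract [:0, 1:] 1 :: 'a::field poly fract) ^ m \<noteq> 1"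
proof -
  have pow: "(Fract [:0, 1:] 1 :: 'a poly fract) ^ m = Fract ([:0, 1:] ^ m) 1"
    by (induction m) (simp_all add: One_fract_def)
  have "([:0, 1:] :: 'a poly) ^ m \<noteq> 1"
  proof
    assume "([:0, 1:] :: 'a poly) ^ m = 1"
    then have "poly ([:0, 1:] ^ m) (0::'a) = 1" by simp
    with assms show False by (simp add: power_0_left)
  qed
  then show ?thesis
    unfolding pow by (simp add: One_fract_def eq_fract)
qed

end

theory Submission imports Defs begin

text \<open>
  Both sides satisfy the recurrence
  \<open>f (h+1) (k+1) = f h (k+1) + q^(h+1) * f (h+1) k + q^(h+1) * f h k\<close>.
  On the path side this is the removal of the last step. For the \<open>q\<close>-Delannoy numbers,
  expand the factor \<open>[h+k-j, k]\<close> by one form of the \<open>q\<close>-Pascal rule and then \<open>[k, j]\<close> by the other.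
\<close>

section \<open>Gaussian binomial coefficients\<close>

text \<open>A recursion instead of a quotient: the recurrence and the path sum can then be treated
  in any commutative ring, and denominators enter only in the comparison with
  \<open>qbinom\<close>.\<close>

fun gauss :: "'a::comm_ring_1 \<Rightarrow> nat \<Rightarrow> nat \<Rightarrow> 'a" where
  "gauss q n 0 = 1"
| "gauss q 0 (Suc k) = 0"
| "gauss q (Suc n) (Suc k) = gauss q n k + q ^ Suc k * gauss q n (Suc k)"

lemma gauss_eq_0: "n < k \<Longrightarrow> gauss q n k = 0"
  by (induction q n k rule: gauss.induct) auto

lemma gauss_self [simp]: "gauss q n n = 1"
  by (induction n) (auto simp: gauss_eq_0)

text \<open>The mirror image of the defining rule. Writing the row as \<open>m + k\<close> avoids a
  truncated subtraction in the exponent. By induction on the row, both entries of the row above are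
  expanded and regrouped by the defining rule.\<close>

lemma gauss_pascal:
  "gauss q (Suc (m + k)) (Suc k) = q ^ m * gauss q (m + k) k + gauss q (m + k) (Suc k)"
proof (induction "m + k" arbitrary: m k)
  case 0
  then show ?case by simp
next
  case (Suc n)
  show ?case
  proof (cases m)
    case 0
    then show ?thesis by (simp add: gauss_eq_0)
  next
    case m: (Suc m')
    have IH1: "gauss q (Suc n) (Suc k) = q ^ m' * gauss q n k + gauss q n (Suc k)"
      using Suc.hyps(1)[of m' k] Suc.hyps(2) m by simp
    show ?thesis
    proof (cases k)
      case 0
      then show ?thesis
        using IH1 Suc.hyps(2) m by (simp add: algebra_simps)
    next
      case k: (Suc k')
      have n: "n = m + k'" "m + k = Suc n"
        using Suc.hyps(2) k by auto
      have IH2: "gauss q (Suc n) k = q ^ m * gauss q n k' + gauss q n k"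
        using Suc.hyps(1)[of m k'] n k by simp
      have "gauss q (Suc (Suc n)) (Suc k)
          = gauss q (Suc n) k + q ^ Suc k * gauss q (Suc n) (Suc k)"
        by (rule gauss.simps)
      \<comment> \<open>Since \<open>m = Suc m'\<close>, one factor \<open>q\<close> moves over:
        \<open>q ^ Suc k * q ^ m' = q ^ m * q ^ k\<close>. Each bracket is then the right-hand side
        of the defining rule.\<close>
      also have "\<dots> = q ^ m * (gauss q n k' + q ^ k * gauss q n k)
          + (gauss q n k + q ^ Suc k * gauss q n (Suc k))"
        unfolding IH1 IH2 using m by (simp add: algebra_simps)
      also have "\<dots> = q ^ m * gauss q (Suc n) k + gauss q (Suc n) (Suc k)"
        using k by simp
      finally show ?thesis
        unfolding n(2) .
    qed
  qed
qed

text \<open>Subtract \<open>q ^ Suc k\<close> times the mirror rule from the defining rule for the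
  same entry: the terms with \<open>gauss q n (Suc k)\<close> cancel. For \<open>k > n\<close> both
  sides vanish.\<close>

lemma gauss_absorb:
  "(1 - q ^ Suc k) * gauss q (Suc n) (Suc k) = (1 - q ^ Suc n) * gauss q n k"
proof (cases "k \<le> n")
  case True
  then obtain m where n: "n = m + k"
    by (metis add.commute le_Suc_ex)
  have "(1 - q ^ Suc k) * gauss q (Suc n) (Suc k)
      = (gauss q n k + q ^ Suc k * gauss q n (Suc k))
        - q ^ Suc k * (q ^ m * gauss q n k + gauss q n (Suc k))"
    using gauss_pascal[of q m k] unfolding n by (simp add: algebra_simps)
  also have "\<dots> = (1 - q ^ Suc n) * gauss q n k"
    unfolding n by (simp add: algebra_simps power_add)
  finally show ?thesis .
qed (simp add: gauss_eq_0)

lemma qbinom_Suc_Suc: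
  "qbinom q (int (Suc n)) (int (Suc k))
     = qint q (int (Suc n)) / qint q (int (Suc k)) * qbinom q (int n) (int k)"
proof -
  have "(\<Prod>i<Suc k. qint q (int (Suc m) - int i))
      = qint q (int (Suc m)) * (\<Prod>i<k. qint q (int m - int i))" for m
    by (subst prod.lessThan_Suc_shift) simp
  from this[of n] this[of k] show ?thesis
    unfolding qbinom_def nat_int by (simp only: times_divide_times_eq) simp
qed

text \<open>Both sides obey the absorption recurrence. Its denominators are the q-integers of
  \<open>1, ..., k\<close>, hence the range of \<open>m\<close> in the hypothesis.\<close>

lemma qbinom_eq_gauss:
  fixes q :: "'a::field"
  assumes "\<And>m::nat. 1 \<le> m \<Longrightarrow> m \<le> k \<Longrightarrow> q ^ m \<noteq> 1"
  shows "qbinom q (int n) (int k) = gauss q n k"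
  using assms
proof (induction q n k rule: gauss.induct)
  case (1 q n)
  then show ?case by (simp add: qbinom_def)
next
  case (2 q k)
  \<comment> \<open>The factor with \<open>i = 0\<close> kills the numerator.\<close>
  have "qint q (int 0 - int 0) = 0"
    by (simp add: qint_def)
  then have "(\<Prod>i<Suc k. qint q (int 0 - int i)) = 0"
    by (intro prod_zero) force+
  then show ?case
    unfolding qbinom_def nat_int by simp
next
  case (3 q n k)
  have q: "q ^ 1 \<noteq> 1" "q ^ Suc k \<noteq> 1"
    using "3.prems"[of 1] "3.prems"[of "Suc k"] by auto
  have "qbinom q (int n) (int k) = gauss q n k"
    by (rule "3.IH"(1)) (rule "3.prems", auto)
  then have "qbinom q (int (Suc n)) (int (Suc k))
      = qint q (int (Suc n)) / qint q (int (Suc k)) * gauss q n k"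
    unfolding qbinom_Suc_Suc by (rule arg_cong)
  also have "\<dots> = (1 - q ^ Suc n) * gauss q n k / (1 - q ^ Suc k)"
    using q unfolding qint_def power_int_of_nat by simp
  also have "\<dots> = gauss q (Suc n) (Suc k)"
    unfolding gauss_absorb[symmetric] using q by simp
  finally show ?case .
qed


section \<open>The recurrence for the q-Delannoy numbers\<close>

definition gauss_Delannoy :: "'a::comm_ring_1 \<Rightarrow> nat \<Rightarrow> nat \<Rightarrow> 'a" where
  "gauss_Delannoy q h k =
     (\<Sum>j\<le>h. q ^ (Suc j choose 2) * gauss q k j * gauss q (h + k - j) k)"

text \<open>The lower indices that occur are \<open>j \<le> h\<close> and \<open>k\<close>, which
  explains the bound \<open>max h k\<close>.\<close>

lemma qDelannoy_eq_gauss_Delannoy: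
  fixes q :: "'a::field"
  assumes "\<And>m::nat. 1 \<le> m \<Longrightarrow> m \<le> max h k \<Longrightarrow> q ^ m \<noteq> 1"
  shows "qDelannoy q h k = gauss_Delannoy q h k"
  unfolding qDelannoy_def gauss_Delannoy_def atMost_atLeast0
proof (rule sum.cong)
  fix j assume "j \<in> {0..h}"
  then have "int h + int k - int j = int (h + k - j)" "j \<le> h"
    by auto
  then show "q ^ ((j + 1) choose 2) * qbinom q (int k) (int j)
        * qbinom q (int h + int k - int j) (int k)
      = q ^ (Suc j choose 2) * gauss q k j * gauss q (h + k - j) k"
    using assms by (simp add: qbinom_eq_gauss del: of_nat_diff)
qed simp

lemma gauss_Delannoy_0_left [simp]: "gauss_Delannoy q 0 k = 1"
  by (simp add: gauss_Delannoy_def numeral_2_eq_2)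

lemma gauss_Delannoy_0_right [simp]: "gauss_Delannoy q h 0 = 1"
proof -
  have "gauss_Delannoy q h 0 = (\<Sum>j\<le>h. if j = 0 then 1 else 0)"
    unfolding gauss_Delannoy_def
    by (rule sum.cong) (auto simp: gauss_eq_0 numeral_2_eq_2)
  then show ?thesis by simp
qed

lemma gauss_Delannoy_Suc_Suc:
  "gauss_Delannoy q (Suc h) (Suc k) = gauss_Delannoy q h (Suc k)
     + q ^ Suc h * gauss_Delannoy q (Suc h) k + q ^ Suc h * gauss_Delannoy q h k"
proof -
  \<comment> \<open>\<open>A\<close> and \<open>q ^ Suc h * B\<close> are the two parts into which
    \<open>gauss_pascal\<close> splits the \<open>j\<close>-th summand.\<close>
  define A where "A j = q ^ (Suc j choose 2) * gauss q (Suc k) j * gauss q (h + Suc k - j) (Suc k)" for j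
  define B where "B j = q ^ (j choose 2) * gauss q (Suc k) j * gauss q (Suc h + k - j) k" for j
  have choose: "Suc j choose 2 = (j choose 2) + j" for j
    by (simp add: numeral_2_eq_2)
  have "q ^ (Suc j choose 2) * gauss q (Suc k) j * gauss q (Suc h + Suc k - j) (Suc k)
      = A j + q ^ Suc h * B j" if "j \<le> Suc h" for j
  proof -
    \<comment> \<open>The mirror rule contributes \<open>q ^ m\<close>, and splitting
      \<open>Suc j choose 2\<close> releases \<open>q ^ j\<close>; together they give
      \<open>q ^ Suc h\<close>, independent of \<open>j\<close>.\<close>
    obtain m where m: "Suc h = m + j"
      using \<open>j \<le> Suc h\<close> by (metis add.commute le_Suc_ex)
    then have idx: "Suc h + Suc k - j = Suc (m + k)" "h + Suc k - j = m + k" "Suc h + k - j = m + k"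
      by auto
    show ?thesis
      unfolding A_def B_def choose idx gauss_pascal
      unfolding m power_add by (simp only: algebra_simps)
  qed
  then have "gauss_Delannoy q (Suc h) (Suc k) = (\<Sum>j\<le>Suc h. A j) + q ^ Suc h * (\<Sum>j\<le>Suc h. B j)"
    unfolding gauss_Delannoy_def by (simp add: sum.distrib sum_distrib_left del: sum.atMost_Suc)
  \<comment> \<open>The top term \<open>j = Suc h\<close> contains
    \<open>gauss q k (Suc k) = 0\<close>.\<close>
  moreover have "(\<Sum>j\<le>Suc h. A j) = gauss_Delannoy q h (Suc k)"
    by (simp add: A_def gauss_Delannoy_def gauss_eq_0)
  moreover have "(\<Sum>j\<le>Suc h. B j) = gauss_Delannoy q (Suc h) k + gauss_Delannoy q h k"
  proof -
    \<comment> \<open>\<open>C\<close> is the summand of \<open>gauss_Delannoy q (Suc h) k\<close>.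
      The defining rule splits \<open>B (Suc j)\<close> into \<open>C (Suc j)\<close> and the
      \<open>j\<close>-th summand of \<open>gauss_Delannoy q h k\<close>.\<close>
    define C where "C j = q ^ (Suc j choose 2) * gauss q k j * gauss q (Suc h + k - j) k" for j
    have "B 0 = C 0"
      by (simp add: B_def C_def numeral_2_eq_2)
    moreover have "B (Suc j) = C (Suc j) + q ^ (Suc j choose 2) * gauss q k j * gauss q (h + k - j) k" for j
      unfolding B_def C_def choose[of "Suc j"] by (simp add: power_add algebra_simps)
    ultimately have "(\<Sum>j\<le>Suc h. B j) = (C 0 + (\<Sum>j\<le>h. C (Suc j)))
        + (\<Sum>j\<le>h. q ^ (Suc j choose 2) * gauss q k j * gauss q (h + k - j) k)"
      by (simp add: sum.atMost_Suc_shift sum.distrib del: sum.atMost_Suc)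
    then show ?thesis
      unfolding gauss_Delannoy_def C_def by (simp add: sum.atMost_Suc_shift del: sum.atMost_Suc)
  qed
  ultimately show ?thesis
    by (simp only: distrib_left add.assoc)
qed


section \<open>The recurrence for lattice paths\<close>

lemma path_x_snoc [simp]: "path_x (l @ [e]) = path_x l + fst e"
  by (simp add: path_x_def)

lemma path_y_snoc [simp]: "path_y (l @ [e]) = path_y l + snd e"
  by (simp add: path_y_def)

lemma path_sigma_Nil [simp]: "path_sigma [] = 0"
  by (simp add: path_sigma_def)

text \<open>Appending a step leaves all earlier endpoints in place, so only the new endpoint can
  contribute. Removing the first step instead would shift every \<open>x\<close>-coordinate.\<close>

lemma path_sigma_snoc:
  "path_sigma (l @ [e]) = path_sigma l + (if snd e = 1 then path_x l + fst e else 0)"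
proof -
  let ?S = "{j. 1 \<le> j \<and> j \<le> length l \<and> snd (l ! (j - 1)) = 1}"
  have fin: "finite ?S"
    by (rule finite_subset[of _ "{..length l}"]) auto
  have S: "{j. 1 \<le> j \<and> j \<le> length (l @ [e]) \<and> snd ((l @ [e]) ! (j - 1)) = 1}
      = (if snd e = 1 then insert (Suc (length l)) ?S else ?S)"
    by (auto simp: nth_append le_Suc_eq split: if_splits)
  have eq: "(\<Sum>j\<in>?S. path_x (take j (l @ [e]))) = path_sigma l"
    unfolding path_sigma_def by (rule sum.cong) auto
  have "path_sigma (l @ [e])
      = (\<Sum>j\<in>(if snd e = 1 then insert (Suc (length l)) ?S else ?S). path_x (take j (l @ [e])))"
    unfolding path_sigma_def[of "l @ [e]"] S ..
  then show ?thesis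
    using fin eq by (cases "snd e = 1") auto
qed

lemma paths_iff_snoc:
  "l @ [e] \<in> paths h k \<longleftrightarrow>
     e \<in> steps \<and> fst e \<le> h \<and> snd e \<le> k \<and> l \<in> paths (h - fst e) (k - snd e)"
  by (auto simp: paths_def)

lemma paths_0_0: "paths 0 0 = {[]}"
proof -
  have "l = []" if "l \<in> paths 0 0" for l
    using that length_le_path[of l] by (simp add: paths_def)
  moreover have "[] \<in> paths 0 0"
    by (simp add: paths_def path_x_def path_y_def)
  ultimately show ?thesis by blast
qed

lemma Nil_in_paths_iff: "[] \<in> paths h k \<longleftrightarrow> h = 0 \<and> k = 0"
  by (auto simp: paths_def path_x_def path_y_def)

lemma paths_Suc_0: "paths (Suc h) 0 = (\<lambda>l. l @ [(1, 0)]) ` paths h 0"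
proof (rule set_eqI)
  fix l show "l \<in> paths (Suc h) 0 \<longleftrightarrow> l \<in> (\<lambda>l. l @ [(1, 0)]) ` paths h 0"
    by (cases l rule: rev_cases) (auto simp: Nil_in_paths_iff paths_iff_snoc steps_def)
qed

lemma paths_0_Suc: "paths 0 (Suc k) = (\<lambda>l. l @ [(0, 1)]) ` paths 0 k"
proof (rule set_eqI)
  fix l show "l \<in> paths 0 (Suc k) \<longleftrightarrow> l \<in> (\<lambda>l. l @ [(0, 1)]) ` paths 0 k"
    by (cases l rule: rev_cases) (auto simp: Nil_in_paths_iff paths_iff_snoc steps_def)
qed

lemma paths_Suc_Suc:
  "paths (Suc h) (Suc k) = (\<lambda>l. l @ [(1, 0)]) ` paths h (Suc k)
     \<union> (\<lambda>l. l @ [(0, 1)]) ` paths (Suc h) k \<union> (\<lambda>l. l @ [(1, 1)]) ` paths h k"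
  (is "_ = ?R")
proof (rule set_eqI)
  fix l show "l \<in> paths (Suc h) (Suc k) \<longleftrightarrow> l \<in> ?R"
    by (cases l rule: rev_cases) (auto simp: Nil_in_paths_iff paths_iff_snoc steps_def)
qed

text \<open>The extra factor comes out of the sum because all extended paths share the final
  \<open>x\<close>-coordinate \<open>h + fst e\<close>.\<close>

lemma sum_paths_snoc:
  "(\<Sum>l\<in>(\<lambda>l. l @ [e]) ` paths h k. q ^ path_sigma l)
     = (if snd e = 1 then q ^ (h + fst e) else 1) * (\<Sum>l\<in>paths h k. q ^ path_sigma l)"
  for q :: "'a::comm_ring_1"
proof -
  have "(\<Sum>l\<in>(\<lambda>l. l @ [e]) ` paths h k. q ^ path_sigma l)
      = (\<Sum>l\<in>paths h k. q ^ path_sigma (l @ [e]))"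
    by (subst sum.reindex) (auto simp: inj_on_def)
  also have "\<dots> = (\<Sum>l\<in>paths h k. (if snd e = 1 then q ^ (h + fst e) else 1) * q ^ path_sigma l)"
    by (rule sum.cong) (auto simp: path_sigma_snoc paths_def power_add)
  finally show ?thesis
    by (simp only: sum_distrib_left)
qed

lemma sum_paths_eq_gauss_Delannoy:
  "(\<Sum>l\<in>paths h k. q ^ path_sigma l) = gauss_Delannoy q h k"
  for q :: "'a::comm_ring_1"
proof (induction "h + k" arbitrary: h k rule: less_induct)
  case less
  consider "h = 0" "k = 0" | h' where "h = Suc h'" "k = 0" | k' where "h = 0" "k = Suc k'"
    | h' k' where "h = Suc h'" "k = Suc k'"
    by (metis not0_implies_Suc)
  then show ?case
  proof cases
    case 1
    then show ?thesis by (simp add: paths_0_0)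
  next
    case 2
    then show ?thesis using less[of h' 0] by (simp add: paths_Suc_0 sum_paths_snoc)
  next
    case 3
    then show ?thesis using less[of 0 k'] by (simp add: paths_0_Suc sum_paths_snoc)
  next
    case 4
    \<comment> \<open>The three images are disjoint because their last steps differ. The vertical
      and the diagonal step both end at \<open>x = Suc h'\<close>, so both carry
      \<open>q ^ Suc h'\<close>.\<close>
    have "(\<Sum>l\<in>paths h k. q ^ path_sigma l)
        = (\<Sum>l\<in>(\<lambda>l. l @ [(1, 0)]) ` paths h' (Suc k'). q ^ path_sigma l)
          + (\<Sum>l\<in>(\<lambda>l. l @ [(0, 1)]) ` paths (Suc h') k'. q ^ path_sigma l)
          + (\<Sum>l\<in>(\<lambda>l. l @ [(1, 1)]) ` paths h' k'. q ^ path_sigma l)"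
      unfolding 4 paths_Suc_Suc by (subst sum.union_disjoint; auto simp: finite_paths)+
    also have "\<dots> = gauss_Delannoy q h k"
      unfolding sum_paths_snoc 4 gauss_Delannoy_Suc_Suc
      using less[of h' "Suc k'"] less[of "Suc h'" k'] less[of h' k'] 4 by simp
    finally show ?thesis .
  qed
qed

theorem theorem2p1:
  fixes q :: "'a::field" and h k :: nat
  assumes "\<And>m::nat. 1 \<le> m \<Longrightarrow> m \<le> max h k \<Longrightarrow> q ^ m \<noteq> 1"
  shows "qDelannoy q h k = (\<Sum>l\<in>paths h k. q ^ path_sigma l)"
  unfolding sum_paths_eq_gauss_Delannoy
  using assms by (rule qDelannoy_eq_gauss_Delannoy)

end
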